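(* Let $K$ be a field complete with respect to a discrete non-archimedean valuation $v$, with uniformizer $\pi$ and residue field $k$. Consider the binomial system $B=(a_1X^{\alpha_1}-b_1X^{\beta_1},\ldots,a_nX^{\alpha_n}-b_nX^{\beta_n})$ in $K[X_1^{\pm1},\ldots,X_n^{\pm1}]$, with $a=(a_1,\ldots,a_n),\,b=(b_1,\ldots,b_n)\in(K^\ast)^n$ and $\alpha_i,\beta_i\in\mathbb{Z}^n$. Assume that the matrix $M\in\mathbb{Z}^{n\times n}$ whose $i$-th row is $\alpha_i-\beta_i$ for $i=1,\ldots,n$ has nonzero determinant. Let $M=PDQ$ be the Smith Normal Form of $M$, i.e. $P,Q\in\mathbb{Z}^{n\times n}$ are invertible over $\mathbb{Z}$ and $D=\mathrm{diag}(d_1,\ldots,d_n)$ with $d_1\mid d_2\mid\cdots\mid d_n$ positive integers. Then $B$ is semiregular at $w=M^{-1}(v(b)-v(a))$ if and only if at least one of the following holds: (1) $w\notin v(\pi)\mathbb{Z}^n$; (2) $\mathrm{char}(k)\nmid\det(M)$; (3) for some $i\in\{1,\ldots,n\}$, the $i$-th entry of $(\delta(b_1/a_1),\ldots,\delta(b_n/a_n))^{P^{-1}}$ is not a $d_i$-th power in $k^\ast$. In this case (i.e. when $B$ is semiregular at $w$), if neither (1) nor (3) holds, then the number of solutions of $B$ in $(K^\ast)^n$ is $|Z_K(B)|=\prod_{i=1}^n|\{\xi\in k^\ast:\xi^{d_i}=1\}|$; otherwise $B$ has no solutions in $(K^\ast)^n$.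
   Context: Let $v:K\to\mathbb{R}\cup\{\infty\}$ be the discrete (nontrivial) valuation, $A=\{x: v(x)\ge 0\}$ the valuation ring, $\mathfrak{M}=\{x:v(x)>0\}=\pi A$ its maximal ideal with a fixed generator $\pi$, and $k=A/\mathfrak{M}$. The first digit of $x\in K^\ast$ is $\delta(x)=\pi^{-v(x)/v(\pi)}x \bmod \mathfrak{M}\in k^\ast$; $v$ is applied componentwise to vectors. For a vector $x=(x_1,\ldots,x_n)$ with nonzero entries in a field and a matrix $M=(m_{ij})\in\mathbb{Z}^{n\times n}$, $x^M=(x_1^{m_{11}}\cdots x_n^{m_{1n}},\ldots,x_1^{m_{n1}}\cdots x_n^{m_{nn}})$. For a nonzero $f=\sum_{i=1}^t a_iX^{\alpha_i}\in K[X_1^{\pm1},\ldots,X_n^{\pm1}]$ (with $a_i\in K^\ast$ and distinct $\alpha_i\in\mathbb{Z}^n$) and $w\in\mathbb{R}^n$, put $l_i(f;w)=v(a_i)+\alpha_i\cdot w$ and $\mathrm{tr}(f;w)=\min_i l_i(f;w)$. The set $\mathrm{Trop}(f)\subseteq\mathbb{R}^n$ consists of the points where $\mathrm{tr}(f;\cdot)$ is not differentiable (equivalently, where the minimum is attained by at least two indices $i$). The initial form is $\mathrm{in}_w(f)=\sum_{i:\,l_i(f;w)=\mathrm{tr}(f;w)}\delta(a_i)X^{\alpha_i}\in k[X_1^{\pm1},\ldots,X_n^{\pm1}]$. For a system $F=(f_1,\ldots,f_n)$: $\mathrm{Trop}(F)=\bigcap_i\mathrm{Trop}(f_i)$ and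 $\mathrm{in}_w(F)=(\mathrm{in}_w(f_1),\ldots,\mathrm{in}_w(f_n))$. A zero of a square system is degenerate if the Jacobian determinant of the system vanishes at it. $F$ is semiregular at $w\in\mathbb{R}^n$ if either $w\notin\mathrm{Trop}(F)\cap v(\pi)\mathbb{Z}^n$ or $\mathrm{in}_w(F)$ has no degenerate zero in $(k^\ast)^n$. $Z_K(F)$ is the set of zeros of $F$ in $(K^\ast)^n$. *)

theory Defs
  imports "HOL-Analysis.Analysis" "HOL-Library.Poly_Mapping"
begin

section \<open>Valued fields\<close>

class valued_field = field +
  fixes val :: "'a \<Rightarrow> ereal"
  assumes val_eq_infinity_iff: "val x = \<infinity> \<longleftrightarrow> x = 0"
    and val_not_minus_infinity: "val x \<noteq> - \<infinity>"
    and val_mult: "val (x * y) = val x + val y"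
    and val_add: "min (val x) (val y) \<le> val (x + y)"

text \<open>The real-valued valuation on nonzero elements; its value at \<open>0\<close> is never meaningful.\<close>

definition rval :: "'a::valued_field \<Rightarrow> real" where
  "rval x = real_of_ereal (val x)"

class discrete_valued_field = valued_field +
  assumes val_nontrivial: "\<exists>x. x \<noteq> 0 \<and> val x \<noteq> 0"
    and val_discrete: "discrete ((\<lambda>x. real_of_ereal (val x)) ` (UNIV - {0}))"

class complete_discrete_valued_field = discrete_valued_field +
  assumes val_complete:
    "(\<And>C::real. \<exists>N. \<forall>m\<ge>N. \<forall>n\<ge>N. ereal C < val (s m - s n)) \<Longrightarrow>
      \<exists>l. \<forall>C::real. \<exists>N. \<forall>n\<ge>N. ereal C < val ((s :: nat \<Rightarrow> 'a) n - l)"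

definition val_ring :: "'a::valued_field set" where
  "val_ring = {x. 0 \<le> val x}"

definition val_ideal :: "'a::valued_field set" where
  "val_ideal = {x. 0 < val x}"

definition uniformizer :: "'a::valued_field \<Rightarrow> bool" where
  "uniformizer \<pi> \<longleftrightarrow> val_ideal = (\<lambda>x. \<pi> * x) ` val_ring"

lemma val_0 [simp]: "val (0::'a::valued_field) = \<infinity>"
  by (simp add: val_eq_infinity_iff)

lemma val_1 [simp]: "val (1::'a::valued_field) = 0"
proof -
  have "val (1::'a) = val (1::'a) + val (1::'a)"
    using val_mult[of "1::'a" 1] by simp
  moreover have "val (1::'a) \<noteq> \<infinity>" "val (1::'a) \<noteq> - \<infinity>"
    by (simp_all add: val_eq_infinity_iff val_not_minus_infinity)
  ultimately show ?thesis by (cases "val (1::'a)") auto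
qed

lemma val_minus [simp]: "val (- x) = val (x::'a::valued_field)"
proof -
  have "val (- 1::'a) + val (- 1::'a) = 0"
    using val_mult[of "- 1::'a" "- 1"] by simp
  then have "val (- 1::'a) = 0" by (cases "val (- 1::'a)") auto
  then show ?thesis using val_mult[of "- 1" x] by simp
qed

lemma val_inverse_unit: "val x = 0 \<Longrightarrow> val (inverse x) = 0" for x :: "'a::valued_field"
proof -
  assume x: "val x = 0"
  then have "x \<noteq> 0" by auto
  then have "val x + val (inverse x) = 0" using val_mult[of x "inverse x"] by simp
  with x show ?thesis by simp
qed

lemma val_ring_add: "x \<in> val_ring \<Longrightarrow> y \<in> val_ring \<Longrightarrow> x + y \<in> val_ring"
  using val_add[of x y] by (auto simp: val_ring_def min_def split: if_splits)

lemma val_ring_mult: "x \<in> val_ring \<Longrightarrow> y \<in> val_ring \<Longrightarrow> x * y \<in> val_ring"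
  by (auto simp: val_ring_def val_mult)

lemma val_ring_minus: "x \<in> val_ring \<Longrightarrow> - x \<in> val_ring"
  by (auto simp: val_ring_def)

lemma val_ring_diff: "x \<in> val_ring \<Longrightarrow> y \<in> val_ring \<Longrightarrow> x - y \<in> val_ring"
  using val_ring_add[of x "- y"] val_ring_minus[of y] by simp

lemma val_ideal_add: "x \<in> val_ideal \<Longrightarrow> y \<in> val_ideal \<Longrightarrow> x + y \<in> val_ideal"
  using val_add[of x y] by (auto simp: val_ideal_def min_def split: if_splits)

lemma val_ideal_minus: "x \<in> val_ideal \<Longrightarrow> - x \<in> val_ideal"
  by (auto simp: val_ideal_def)

lemma val_ideal_mult: "x \<in> val_ring \<Longrightarrow> y \<in> val_ideal \<Longrightarrow> x * y \<in> val_ideal"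
  by (auto simp: val_ring_def val_ideal_def val_mult intro: add_nonneg_pos)

lemma val_ideal_0: "0 \<in> val_ideal"
  by (simp add: val_ideal_def)

section \<open>The residue field\<close>

definition residue_rel :: "'a::valued_field \<Rightarrow> 'a \<Rightarrow> bool" where
  "residue_rel x y \<longleftrightarrow> x \<in> val_ring \<and> y \<in> val_ring \<and> x - y \<in> val_ideal"

lemma residue_rel_part_equivp: "part_equivp (residue_rel :: 'a::valued_field \<Rightarrow> _)"
proof (rule part_equivpI)
  show "\<exists>x::'a. residue_rel x x"
    by (rule exI[of _ 0]) (simp add: residue_rel_def val_ring_def val_ideal_def)
  show "symp (residue_rel :: 'a \<Rightarrow> _)"
    using val_ideal_minus by (fastforce simp: symp_def residue_rel_def)
  show "transp (residue_rel :: 'a \<Rightarrow> _)"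
  proof (rule transpI)
    fix x y z :: 'a
    assume "residue_rel x y" "residue_rel y z"
    then show "residue_rel x z"
      using val_ideal_add[of "x - y" "y - z"] by (simp add: residue_rel_def)
  qed
qed

text \<open>The quotient of the valuation ring by its maximal ideal; the underlying partial equivalence
  relation is only reflexive on the valuation ring.\<close>

quotient_type (overloaded) 'a residue_field = "'a::valued_field" / partial: residue_rel
  by (rule residue_rel_part_equivp)

instantiation residue_field :: (valued_field) field
begin

lift_definition zero_residue_field :: "'a residue_field" is 0
  by (simp add: residue_rel_def val_ring_def val_ideal_def)

lift_definition one_residue_field :: "'a residue_field" is 1
  by (simp add: residue_rel_def val_ring_def val_ideal_def)

lift_definition plus_residue_field :: "'a residue_field \<Rightarrow> 'a residue_field \<Rightarrow> 'a residue_field"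
  is "(+)"
proof -
  fix x x' y y' :: 'a
  assume "residue_rel x x'" "residue_rel y y'"
  then show "residue_rel (x + y) (x' + y')"
    using val_ideal_add[of "x - x'" "y - y'"]
    by (auto simp: residue_rel_def algebra_simps intro: val_ring_add)
qed

lift_definition uminus_residue_field :: "'a residue_field \<Rightarrow> 'a residue_field" is uminus
proof -
  fix x x' :: 'a
  assume "residue_rel x x'"
  then show "residue_rel (- x) (- x')"
    using val_ideal_minus[of "x - x'"] by (auto simp: residue_rel_def intro: val_ring_minus)
qed

lift_definition minus_residue_field :: "'a residue_field \<Rightarrow> 'a residue_field \<Rightarrow> 'a residue_field"
  is "(-)"
proof -
  fix x x' y y' :: 'a
  assume *: "residue_rel x x'" "residue_rel y y'"
  have "(x - x') + - (y - y') \<in> val_ideal"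
    using * by (intro val_ideal_add val_ideal_minus) (auto simp: residue_rel_def)
  moreover have "x - y \<in> val_ring" "x' - y' \<in> val_ring"
    using * by (auto simp: residue_rel_def intro: val_ring_diff)
  ultimately show "residue_rel (x - y) (x' - y')"
    by (simp add: residue_rel_def algebra_simps)
qed

lift_definition times_residue_field :: "'a residue_field \<Rightarrow> 'a residue_field \<Rightarrow> 'a residue_field"
  is "(*)"
proof -
  fix x x' y y' :: 'a
  assume *: "residue_rel x x'" "residue_rel y y'"
  have "y * (x - x') + x' * (y - y') \<in> val_ideal"
    using * by (intro val_ideal_add val_ideal_mult) (auto simp: residue_rel_def)
  moreover have "y * (x - x') + x' * (y - y') = x * y - x' * y'"
    by (simp add: algebra_simps)
  ultimately show "residue_rel (x * y) (x' * y')"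
    using * by (auto simp: residue_rel_def intro: val_ring_mult)
qed

lemma val_eq_0_if_residue_rel:
  assumes "residue_rel x (x'::'a)" "\<not> 0 < val x"
  shows "val x = 0" "val x' = 0"
proof -
  show "val x = 0" using assms by (auto simp: residue_rel_def val_ring_def)
  have "\<not> 0 < val x'"
  proof
    assume "0 < val x'"
    then have "(x - x') + x' \<in> val_ideal"
      using assms by (intro val_ideal_add) (auto simp: residue_rel_def val_ideal_def)
    then show False using assms by (simp add: val_ideal_def)
  qed
  then show "val x' = 0" using assms by (auto simp: residue_rel_def val_ring_def)
qed

lift_definition inverse_residue_field :: "'a residue_field \<Rightarrow> 'a residue_field"
  is "\<lambda>x. if 0 < val x then 0 else inverse x"
proof -
  fix x x' :: 'a
  assume *: "residue_rel x x'"
  then have sym: "residue_rel x' x"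
    using residue_rel_part_equivp by (metis part_equivp_symp)
  show "residue_rel (if 0 < val x then 0 else inverse x) (if 0 < val x' then 0 else inverse x')"
  proof (cases "0 < val x")
    case True
    then have "0 < val x'" using val_eq_0_if_residue_rel(2)[OF sym] by fastforce
    with True show ?thesis by (simp add: residue_rel_def val_ring_def val_ideal_def)
  next
    case False
    note u = val_eq_0_if_residue_rel[OF * False]
    then have "x \<noteq> 0" "x' \<noteq> 0" by auto
    then have "inverse x - inverse x' = (inverse x * inverse x') * (x' - x)"
      by (simp add: field_simps)
    moreover have "(inverse x * inverse x') * (x' - x) \<in> val_ideal"
      using sym u by (intro val_ideal_mult val_ring_mult)
        (auto simp: residue_rel_def val_ring_def val_inverse_unit)
    ultimately show ?thesis
      using u by (auto simp: residue_rel_def val_ring_def val_inverse_unit)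
  qed
qed

definition divide_residue_field :: "'a residue_field \<Rightarrow> 'a residue_field \<Rightarrow> 'a residue_field"
  where "divide_residue_field x y = x * inverse y"

instance
proof
  fix x y z :: "'a residue_field"
  show "x * y * z = x * (y * z)"
    by transfer (simp add: residue_rel_def mult.assoc val_ideal_0 val_ring_mult)
  show "x * y = y * x"
    by transfer (simp add: residue_rel_def mult.commute val_ideal_0 val_ring_mult)
  show "1 * x = x"
    by transfer (simp add: residue_rel_def val_ideal_0)
  show "x + y + z = x + (y + z)"
    by transfer (simp add: residue_rel_def add.assoc val_ideal_0 val_ring_add)
  show "x + y = y + x"
    by transfer (simp add: residue_rel_def add.commute val_ideal_0 val_ring_add)
  show "0 + x = x"
    by transfer (simp add: residue_rel_def val_ideal_0)
  show "- x + x = 0"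
    by transfer (simp add: residue_rel_def val_ideal_0 val_ring_def)
  show "x - y = x + - y"
    by transfer (simp add: residue_rel_def val_ideal_0 val_ring_diff)
  show "(x + y) * z = x * z + y * z"
    by transfer (simp add: residue_rel_def algebra_simps val_ideal_0 val_ring_add val_ring_mult)
  show "(0::'a residue_field) \<noteq> 1"
    by transfer (simp add: residue_rel_def val_ideal_def)
  show "x \<noteq> 0 \<Longrightarrow> inverse x * x = 1"
  proof (transfer, goal_cases)
    case (1 x)
    then have "\<not> 0 < val x" by (auto simp: residue_rel_def val_ideal_def val_ring_def)
    moreover from this have "x \<noteq> 0" by auto
    ultimately show ?case by (simp add: residue_rel_def val_ring_def val_ideal_0)
  qed
  show "x div y = x * inverse y" by (simp add: divide_residue_field_def)
  show "inverse (0::'a residue_field) = 0"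
    by transfer (simp add: residue_rel_def val_ring_def val_ideal_0)
qed

end

text \<open>The class of \<open>x\<close> modulo the maximal ideal, meaningful only for \<open>x \<in> val_ring\<close>.\<close>

definition residue :: "'a::valued_field \<Rightarrow> 'a residue_field" where
  "residue x = abs_residue_field x"

text \<open>For a uniformizer \<open>\<pi>\<close> and \<open>x \<noteq> 0\<close> the quotient \<open>rval x / rval \<pi>\<close> is an integer, so the floor
  only changes its type.\<close>

definition first_digit :: "'a::valued_field \<Rightarrow> 'a \<Rightarrow> 'a residue_field" where
  "first_digit \<pi> x = residue (\<pi> powi (- \<lfloor>rval x / rval \<pi>\<rfloor>) * x)"

section \<open>Laurent polynomials and monomial maps\<close>

text \<open>A Laurent polynomial is the finitely supported map from exponent vectors to coefficients.\<close>

type_synonym ('a, 'n) laurent = "(int ^ 'n) \<Rightarrow>\<^sub>0 'a"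

definition monomial_eval :: "'a::field ^ 'n \<Rightarrow> int ^ 'n \<Rightarrow> 'a" where
  "monomial_eval x \<alpha> = (\<Prod>j\<in>UNIV. x $ j powi \<alpha> $ j)"

definition matrix_power_map :: "'a::field ^ 'n \<Rightarrow> int ^ 'n ^ 'n \<Rightarrow> 'a ^ 'n" where
  "matrix_power_map x M = (\<chi> i. monomial_eval x (M $ i))"

definition laurent_eval :: "('a::field, 'n::finite) laurent \<Rightarrow> 'a ^ 'n \<Rightarrow> 'a" where
  "laurent_eval f x = (\<Sum>\<alpha>\<in>Poly_Mapping.keys f. Poly_Mapping.lookup f \<alpha> * monomial_eval x \<alpha>)"

definition laurent_pderiv :: "'n \<Rightarrow> ('a::field, 'n::finite) laurent \<Rightarrow> ('a, 'n) laurent" where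
  "laurent_pderiv j f =
    (\<Sum>\<alpha>\<in>Poly_Mapping.keys f. Poly_Mapping.single (\<alpha> - axis j 1) (of_int (\<alpha> $ j) * Poly_Mapping.lookup f \<alpha>))"

definition torus :: "('a::field ^ 'n) set" where
  "torus = {x. \<forall>j. x $ j \<noteq> 0}"

definition torus_zeros :: "('a::field, 'n::finite) laurent ^ 'n \<Rightarrow> ('a ^ 'n) set" where
  "torus_zeros F = {x \<in> torus. \<forall>i. laurent_eval (F $ i) x = 0}"

definition jacobian_det :: "('a::field, 'n::finite) laurent ^ 'n \<Rightarrow> 'a ^ 'n \<Rightarrow> 'a" where
  "jacobian_det F x = det (\<chi> i j. laurent_eval (laurent_pderiv j (F $ i)) x)"

section \<open>Tropical notions\<close>

definition trop_weight :: "('a::valued_field, 'n::finite) laurent \<Rightarrow> real ^ 'n \<Rightarrow> int ^ 'n \<Rightarrow> real"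
  where "trop_weight f w \<alpha> = rval (Poly_Mapping.lookup f \<alpha>) + (\<chi> j. real_of_int (\<alpha> $ j)) \<bullet> w"

text \<open>This and the following notions are only meaningful for nonzero Laurent polynomials.\<close>

definition trop_fun :: "('a::valued_field, 'n::finite) laurent \<Rightarrow> real ^ 'n \<Rightarrow> real" where
  "trop_fun f w = Min (trop_weight f w ` Poly_Mapping.keys f)"

definition Trop :: "('a::valued_field, 'n::finite) laurent \<Rightarrow> (real ^ 'n) set" where
  "Trop f = {w. \<not> trop_fun f differentiable (at w)}"

definition Trop_system :: "('a::valued_field, 'n::finite) laurent ^ 'n \<Rightarrow> (real ^ 'n) set" where
  "Trop_system F = (\<Inter>i. Trop (F $ i))"

definition initial_form ::
  "'a::valued_field \<Rightarrow> real ^ 'n \<Rightarrow> ('a, 'n::finite) laurent \<Rightarrow> ('a residue_field, 'n) laurent" where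
  "initial_form \<pi> w f =
    (\<Sum>\<alpha> | \<alpha> \<in> Poly_Mapping.keys f \<and> trop_weight f w \<alpha> = trop_fun f w.
      Poly_Mapping.single \<alpha> (first_digit \<pi> (Poly_Mapping.lookup f \<alpha>)))"

definition initial_system ::
  "'a::valued_field \<Rightarrow> real ^ 'n \<Rightarrow> ('a, 'n::finite) laurent ^ 'n \<Rightarrow> ('a residue_field, 'n) laurent ^ 'n"
  where "initial_system \<pi> w F = (\<chi> i. initial_form \<pi> w (F $ i))"

text \<open>The lattice of real vectors all of whose entries are integer multiples of the valuation
  of \<open>\<pi>\<close>.\<close>

definition value_lattice :: "'a::valued_field \<Rightarrow> (real ^ 'n) set" where
  "value_lattice \<pi> = {w. \<forall>j. \<exists>m::int. w $ j = rval \<pi> * real_of_int m}"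

definition semiregular ::
  "'a::valued_field \<Rightarrow> ('a, 'n::finite) laurent ^ 'n \<Rightarrow> real ^ 'n \<Rightarrow> bool" where
  "semiregular \<pi> F w \<longleftrightarrow>
    w \<notin> Trop_system F \<inter> value_lattice \<pi> \<or>
    \<not> (\<exists>x \<in> torus_zeros (initial_system \<pi> w F). jacobian_det (initial_system \<pi> w F) x = 0)"

section \<open>Binomial systems and Smith normal form\<close>

definition binomial_system ::
  "'a::field ^ 'n \<Rightarrow> 'a ^ 'n \<Rightarrow> int ^ 'n ^ 'n \<Rightarrow> int ^ 'n ^ 'n \<Rightarrow> ('a, 'n::finite) laurent ^ 'n" where
  "binomial_system a b \<alpha> \<beta> =
    (\<chi> i. Poly_Mapping.single (\<alpha> $ i) (a $ i) - Poly_Mapping.single (\<beta> $ i) (b $ i))"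

text \<open>The linear order on the index type stands for the order of the indices \<open>1, \<dots>, n\<close>;
  it is only needed for the divisibility chain.\<close>

definition smith_normal_form ::
  "((int, 'n) vec, 'n) vec \<Rightarrow> ((int, 'n) vec, 'n) vec \<Rightarrow> ('n::{finite,linorder} \<Rightarrow> nat) \<Rightarrow>
    ((int, 'n) vec, 'n) vec \<Rightarrow> bool" where
  "smith_normal_form M P d Q \<longleftrightarrow>
    invertible P \<and> invertible Q \<and>
    (\<forall>i. 0 < d i) \<and> (\<forall>i j. i \<le> j \<longrightarrow> d i dvd d j) \<and>
    M = P ** (\<chi> i j. if i = j then int (d i) else 0) ** Q"

end

theory Submission
  imports Defs
begin

text \<open>
  A binomial system is a single equation \<open>x\<^sup>M = b / a\<close> in the torus, and the Smith normal form
  \<open>M = P D Q\<close> decouples it: in the coordinates \<open>y = x\<^sup>Q\<close> it says \<open>y\<^sub>i\<close> to the power \<open>d\<^sub>i\<close> equals \<open>e\<^sub>i\<close>,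
  where \<open>e = (b / a)\<close> raised to the inverse of \<open>P\<close> (\<open>bij_betw_monomial_solutions\<close>). This holds over
  every field, in particular over the valued field \<open>K\<close> and over its residue field \<open>k\<close>.

  Semiregularity. Off the value lattice, which is condition (1), semiregularity holds by
  definition. On the lattice it is a question about degenerate zeros over \<open>k\<close>. The point \<open>w\<close> is
  where the two terms of every binomial tie. As \<open>det M \<noteq> 0\<close>, these terms have distinct exponents,
  so \<open>w\<close> lies in the tropical variety (\<open>mem_Trop_two_terms\<close>), and the initial system there is the
  binomial system over \<open>k\<close> with the same exponents and with the first digits of \<open>a\<close> and \<open>b\<close> as
  coefficients (\<open>initial_form_binomial\<close>). Its Jacobian determinant at a zero is a unit times
  \<open>det M\<close> (\<open>jacobian_det_binomial_system_eq_0_iff\<close>), so it has a degenerate zero exactly if it has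
  a zero at all and the characteristic of \<open>k\<close> divides \<open>det M\<close>. By the decoupling over \<open>k\<close>, it has
  a zero exactly if every required root exists, that is, if condition (3) fails.

  Counting. A zero of \<open>B\<close> must have value \<open>w\<close>, which puts \<open>w\<close> on the value lattice, and the first
  digits of its decoupled coordinates are the roots that condition (3) denies; so under (1) or (3)
  there are no zeros. Otherwise semiregularity leaves only condition (2). The product of the \<open>d\<^sub>i\<close>
  is \<open>det M\<close> up to a sign, so every \<open>d\<^sub>i\<close> is then invertible in \<open>k\<close>. The value of \<open>e\<^sub>i\<close> is a multiple
  of \<open>d\<^sub>i\<close> in the value group, and Hensel's lemma for pure powers shows that the first digit is a
  bijection from the roots of \<open>e\<^sub>i\<close> in \<open>K\<close> to the roots of its first digit in \<open>k\<close>
  (\<open>bij_betw_first_digit_roots\<close>). The latter form a coset of the group of \<open>d\<^sub>i\<close>-th roots of unity.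
\<close>

section \<open>Monomial maps on the torus\<close>

lemma power_int_sum:
  fixes x :: "'a::field"
  assumes "x \<noteq> 0"
  shows "x powi (\<Sum>i\<in>A. k i) = (\<Prod>i\<in>A. x powi k i)"
  by (induction A rule: infinite_finite_induct) (use assms in \<open>auto simp: power_int_add\<close>)

lemma power_int_prod:
  fixes f :: "'b \<Rightarrow> 'a::field"
  shows "(\<Prod>i\<in>A. f i) powi k = (\<Prod>i\<in>A. f i powi k)"
  by (induction A rule: infinite_finite_induct) (auto simp: power_int_mult_distrib)

lemma monomial_eval_nonzero: "x \<in> torus \<Longrightarrow> monomial_eval x \<gamma> \<noteq> 0"
  by (simp add: monomial_eval_def torus_def)

lemma monomial_eval_diff:
  "x \<in> torus \<Longrightarrow> monomial_eval x (\<gamma> - \<gamma>') = monomial_eval x \<gamma> / monomial_eval x \<gamma>'"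
  by (simp add: monomial_eval_def torus_def power_int_diff prod_dividef)

lemma monomial_eval_axis: "monomial_eval x (axis j k) = x $ j powi k"
proof -
  have "monomial_eval x (axis j k) = (\<Prod>i\<in>UNIV. if i = j then x $ j powi k else 1)"
    unfolding monomial_eval_def by (intro prod.cong) (auto simp: axis_def)
  then show ?thesis by simp
qed

lemma matrix_power_map_in_torus: "x \<in> torus \<Longrightarrow> matrix_power_map x A \<in> torus"
  by (simp add: matrix_power_map_def torus_def monomial_eval_nonzero[unfolded torus_def])

lemma matrix_power_map_nth: "matrix_power_map x A $ i = (\<Prod>j\<in>UNIV. x $ j powi A $ i $ j)"
  by (simp add: matrix_power_map_def monomial_eval_def)

text \<open>Exponent matrices act on the torus from the left, so an integrally invertible matrix is a
  bijective change of coordinates there.\<close>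
lemma matrix_power_map_mult:
  fixes x :: "'a::field ^ 'n::finite"
  assumes "x \<in> torus"
  shows "matrix_power_map x (A ** B) = matrix_power_map (matrix_power_map x B) A"
proof -
  have "(\<Prod>k\<in>UNIV. x $ k powi (\<Sum>j\<in>UNIV. A $ i $ j * B $ j $ k)) =
        (\<Prod>j\<in>UNIV. (\<Prod>k\<in>UNIV. x $ k powi B $ j $ k) powi A $ i $ j)" for i
  proof -
    have "(\<Prod>k\<in>UNIV. x $ k powi (\<Sum>j\<in>UNIV. A $ i $ j * B $ j $ k)) =
        (\<Prod>k\<in>UNIV. \<Prod>j\<in>UNIV. (x $ k powi B $ j $ k) powi A $ i $ j)"
      using assms by (simp add: power_int_sum torus_def power_int_mult[symmetric] mult.commute)
    also have "\<dots> = (\<Prod>j\<in>UNIV. \<Prod>k\<in>UNIV. (x $ k powi B $ j $ k) powi A $ i $ j)"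
      by (rule prod.swap)
    finally show ?thesis by (simp add: power_int_prod)
  qed
  then show ?thesis by (simp add: vec_eq_iff matrix_power_map_nth matrix_matrix_mult_def)
qed

lemma matrix_power_map_diagonal:
  "matrix_power_map x (\<chi> i j. if i = j then int (d i) else 0) $ i = x $ i ^ d i"
proof -
  have "(\<Prod>j\<in>UNIV. x $ j powi (if i = j then int (d i) else 0)) =
        (\<Prod>j\<in>UNIV. if i = j then x $ i ^ d i else 1)"
    by (intro prod.cong) auto
  then show ?thesis by (simp add: matrix_power_map_nth)
qed

lemma matrix_power_map_one: "matrix_power_map x (mat 1) = x"
  using matrix_power_map_diagonal[of x "\<lambda>_. 1"] unfolding of_nat_1 by (simp add: vec_eq_iff mat_def)

lemma matrix_inv_inverse:
  fixes A :: "'b::semiring_1 ^ 'n::finite ^ 'n"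
  assumes "invertible A"
  shows "A ** matrix_inv A = mat 1" "matrix_inv A ** A = mat 1"
proof -
  have "A ** matrix_inv A = mat 1 \<and> matrix_inv A ** A = mat 1"
    using assms unfolding matrix_inv_def invertible_def by (rule someI_ex)
  then show "A ** matrix_inv A = mat 1" "matrix_inv A ** A = mat 1" by auto
qed

lemma matrix_power_map_matrix_inv:
  fixes x :: "'a::field ^ 'n::finite"
  assumes "invertible A" "x \<in> torus"
  shows "matrix_power_map (matrix_power_map x A) (matrix_inv A) = x"
    and "matrix_power_map (matrix_power_map x (matrix_inv A)) A = x"
  using assms matrix_inv_inverse[OF assms(1)]
  by (simp_all add: matrix_power_map_mult[symmetric] matrix_power_map_one)

text \<open>With \<open>M = P D Q\<close> the equation \<open>x\<^sup>M = c\<close> reads \<open>((x\<^sup>Q)\<^sup>D)\<^sup>P = c\<close>. Both \<open>P\<close> and \<open>Q\<close> act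
  bijectively on the torus, so raising to \<open>P\<close> can be undone on the right-hand side, and in the
  coordinates \<open>y = x\<^sup>Q\<close> the system decouples into one pure power equation per index. This is
  applied over the valued field and over its residue field.\<close>
lemma bij_betw_monomial_solutions:
  fixes c :: "'a::field ^ 'n::{finite,linorder}"
  assumes snf: "smith_normal_form M P d Q" and c: "c \<in> torus"
  shows "bij_betw (\<lambda>x. matrix_power_map x Q) {x \<in> torus. matrix_power_map x M = c}
           {y. \<forall>i. y $ i \<noteq> 0 \<and> y $ i ^ d i = matrix_power_map c (matrix_inv P) $ i}"
    (is "bij_betw _ ?X ?Y")
proof -
  let ?D = "(\<chi> i j. if i = j then int (d i) else 0) :: ((int, 'n) vec, 'n) vec"
  have P: "invertible P" and Q: "invertible Q" and M: "M = P ** ?D ** Q"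
    using snf by (auto simp: smith_normal_form_def)
  have iff: "matrix_power_map x M = c \<longleftrightarrow>
      (\<forall>i. matrix_power_map x Q $ i ^ d i = matrix_power_map c (matrix_inv P) $ i)"
    if x: "x \<in> torus" for x :: "('a, 'n) vec"
  proof -
    let ?y = "matrix_power_map (matrix_power_map x Q) ?D"
    have y: "?y \<in> torus" by (intro matrix_power_map_in_torus x)
    have eq: "matrix_power_map x M = matrix_power_map ?y P"
      by (simp add: M matrix_power_map_mult x matrix_power_map_in_torus)
    have "matrix_power_map x M = c \<longleftrightarrow> ?y = matrix_power_map c (matrix_inv P)"
      unfolding eq
      using matrix_power_map_matrix_inv(1)[OF P y] matrix_power_map_matrix_inv(2)[OF P c] by auto
    then show ?thesis by (simp add: vec_eq_iff matrix_power_map_diagonal)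
  qed
  show ?thesis
  proof (rule bij_betw_byWitness[where f' = "\<lambda>y. matrix_power_map y (matrix_inv Q)"])
    show "\<forall>x\<in>?X. matrix_power_map (matrix_power_map x Q) (matrix_inv Q) = x"
      by (simp add: matrix_power_map_matrix_inv(1)[OF Q])
    show "\<forall>y\<in>?Y. matrix_power_map (matrix_power_map y (matrix_inv Q)) Q = y"
      by (simp add: matrix_power_map_matrix_inv(2)[OF Q] torus_def)
    show "(\<lambda>x. matrix_power_map x Q) ` ?X \<subseteq> ?Y"
    proof (rule image_subsetI)
      fix x assume "x \<in> ?X"
      then show "matrix_power_map x Q \<in> ?Y"
        using iff[of x] matrix_power_map_in_torus[of x Q] by (simp add: torus_def)
    qed
    show "(\<lambda>y. matrix_power_map y (matrix_inv Q)) ` ?Y \<subseteq> ?X"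
    proof (rule image_subsetI)
      fix y assume y: "y \<in> ?Y"
      then have t: "y \<in> torus" by (simp add: torus_def)
      then have "matrix_power_map y (matrix_inv Q) \<in> torus"
        by (rule matrix_power_map_in_torus)
      with y show "matrix_power_map y (matrix_inv Q) \<in> ?X"
        using iff matrix_power_map_matrix_inv(2)[OF Q t] by simp
    qed
  qed
qed

lemma bij_betw_vec_PiE:
  "bij_betw vec_nth {y. \<forall>i. y $ i \<in> S i} (PiE UNIV S)"
  by (rule bij_betw_byWitness[where f' = "\<lambda>f. \<chi> i. f i"]) auto

section \<open>Binomial systems over an arbitrary field\<close>

lemma laurent_eval_eq_sum:
  assumes "finite A" "Poly_Mapping.keys f \<subseteq> A"
  shows "laurent_eval f x = (\<Sum>\<gamma>\<in>A. Poly_Mapping.lookup f \<gamma> * monomial_eval x \<gamma>)"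
  unfolding laurent_eval_def
  by (intro sum.mono_neutral_left) (use assms in \<open>auto simp: in_keys_iff\<close>)

lemma laurent_eval_single [simp]:
  "laurent_eval (Poly_Mapping.single \<gamma> c) x = c * monomial_eval x \<gamma>"
  by (simp add: laurent_eval_def)

lemma laurent_eval_diff [simp]: "laurent_eval (f - g) x = laurent_eval f x - laurent_eval g x"
proof -
  let ?A = "Poly_Mapping.keys f \<union> Poly_Mapping.keys g"
  have "Poly_Mapping.keys (f - g) \<subseteq> ?A" by (auto simp: in_keys_iff lookup_minus)
  then show ?thesis
    by (simp add: laurent_eval_eq_sum[of ?A] lookup_minus left_diff_distrib sum_subtractf)
qed

lemma laurent_eval_add [simp]: "laurent_eval (f + g) x = laurent_eval f x + laurent_eval g x"
proof -
  let ?A = "Poly_Mapping.keys f \<union> Poly_Mapping.keys g"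
  have "Poly_Mapping.keys (f + g) \<subseteq> ?A" by (auto simp: in_keys_iff lookup_add)
  then show ?thesis
    by (simp add: laurent_eval_eq_sum[of ?A] lookup_add distrib_right sum.distrib)
qed

lemma keys_binomial:
  fixes c e :: "'a::field"
  assumes "\<gamma> \<noteq> \<gamma>'" "c \<noteq> 0" "e \<noteq> 0"
  shows "Poly_Mapping.keys (Poly_Mapping.single \<gamma> c - Poly_Mapping.single \<gamma>' e) = {\<gamma>, \<gamma>'}"
  using assms by (auto simp: in_keys_iff lookup_minus lookup_single when_def split: if_splits)

lemma torus_zeros_binomial_system:
  fixes a b :: "'a::field ^ 'n::finite"
  assumes a: "a \<in> torus" and b: "b \<in> torus"
  shows "torus_zeros (binomial_system a b \<alpha> \<beta>) =
    {x \<in> torus. matrix_power_map x (\<chi> i. \<alpha> $ i - \<beta> $ i) = (\<chi> i. b $ i / a $ i)}"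
proof -
  have "a $ i * monomial_eval x (\<alpha> $ i) = b $ i * monomial_eval x (\<beta> $ i) \<longleftrightarrow>
      monomial_eval x (\<alpha> $ i - \<beta> $ i) = b $ i / a $ i" if "x \<in> torus" for x i
  proof -
    have "a $ i \<noteq> 0" using a by (simp add: torus_def)
    with monomial_eval_nonzero[OF that] show ?thesis
      unfolding monomial_eval_diff[OF that] by (auto simp: field_simps)
  qed
  then show ?thesis
    by (auto simp: torus_zeros_def binomial_system_def vec_eq_iff matrix_power_map_def)
qed

text \<open>The division by \<open>x $ j\<close> is the drop of the \<open>j\<close>-th exponent by one.\<close>
lemma laurent_eval_laurent_pderiv_binomial:
  fixes c e :: "'a::field" and \<gamma> \<gamma>' :: "int ^ 'n::finite"
  assumes "\<gamma> \<noteq> \<gamma>'" "c \<noteq> 0" "e \<noteq> 0" "x \<in> torus"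
  shows "laurent_eval (laurent_pderiv j (Poly_Mapping.single \<gamma> c - Poly_Mapping.single \<gamma>' e)) x =
    (of_int (\<gamma> $ j) * c * monomial_eval x \<gamma> - of_int (\<gamma>' $ j) * e * monomial_eval x \<gamma>') / x $ j"
  using assms unfolding laurent_pderiv_def keys_binomial[OF assms(1-3)]
  by (simp add: lookup_minus lookup_single when_def monomial_eval_diff monomial_eval_axis
      diff_divide_distrib)

lemma det_scale_rows_columns:
  fixes N :: "'a::comm_ring_1 ^ 'n::finite ^ 'n"
  shows "det (\<chi> i j. r i * N $ i $ j * s j) = (\<Prod>i\<in>UNIV. r i) * (\<Prod>j\<in>UNIV. s j) * det N"
proof -
  have "(\<Prod>i\<in>UNIV. r i * N $ i $ p i * s (p i)) =
      (\<Prod>i\<in>UNIV. r i) * (\<Prod>j\<in>UNIV. s j) * (\<Prod>i\<in>UNIV. N $ i $ p i)"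
    if "p permutes (UNIV :: 'n set)" for p
    using prod.permute[OF that, of s] by (simp add: prod.distrib o_def mult_ac)
  then show ?thesis
    unfolding det_def sum_distrib_left by (intro sum.cong) (auto simp: mult_ac)
qed

lemma det_of_int:
  fixes N :: "int ^ 'n::finite ^ 'n"
  shows "det ((\<chi> i j. of_int (N $ i $ j)) :: 'a::comm_ring_1 ^ 'n ^ 'n) = of_int (det N)"
  by (simp add: det_def)

text \<open>At a zero the two monomials of the \<open>i\<close>-th binomial have a common value \<open>r i \<noteq> 0\<close>, so the
  \<open>(i, j)\<close> entry of the Jacobian matrix is \<open>r i * (\<alpha> - \<beta>) $ i $ j / x $ j\<close>. Hence the Jacobian
  determinant is a nonzero multiple of the image of the integer \<open>det (\<alpha> - \<beta>)\<close> in the field: all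
  zeros are degenerate, or none is.\<close>
lemma jacobian_det_binomial_system_eq_0_iff:
  fixes a b :: "'a::field ^ 'n::finite"
  assumes a: "a \<in> torus" and b: "b \<in> torus" and ne: "\<And>i. \<alpha> $ i \<noteq> \<beta> $ i"
    and x: "x \<in> torus_zeros (binomial_system a b \<alpha> \<beta>)"
  shows "jacobian_det (binomial_system a b \<alpha> \<beta>) x = 0 \<longleftrightarrow>
    int CHAR('a) dvd det (\<chi> i. \<alpha> $ i - \<beta> $ i)"
proof -
  let ?M = "\<chi> i. \<alpha> $ i - \<beta> $ i"
  define r where "r i = a $ i * monomial_eval x (\<alpha> $ i)" for i
  have xt: "x \<in> torus" using x by (simp add: torus_zeros_def)
  have nz: "a $ i \<noteq> 0" "b $ i \<noteq> 0" for i
    using a b by (auto simp: torus_def)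
  have eq: "b $ i * monomial_eval x (\<beta> $ i) = r i" for i
    using x by (simp add: torus_zeros_def binomial_system_def r_def)
  have "laurent_eval (laurent_pderiv j (binomial_system a b \<alpha> \<beta> $ i)) x =
      r i * of_int (?M $ i $ j) * inverse (x $ j)" for i j
  proof -
    have "laurent_eval (laurent_pderiv j (binomial_system a b \<alpha> \<beta> $ i)) x =
      (of_int (\<alpha> $ i $ j) * r i - of_int (\<beta> $ i $ j) * (b $ i * monomial_eval x (\<beta> $ i))) / x $ j"
      using laurent_eval_laurent_pderiv_binomial[OF ne nz xt]
      by (simp add: binomial_system_def r_def mult_ac)
    then show ?thesis unfolding eq by (simp add: algebra_simps divide_inverse)
  qed
  then have "jacobian_det (binomial_system a b \<alpha> \<beta>) x =
      det (\<chi> i j. r i * (\<chi> i j. of_int (?M $ i $ j)) $ i $ j * inverse (x $ j))"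
    by (simp add: jacobian_det_def)
  also have "\<dots> = (\<Prod>i\<in>UNIV. r i) * (\<Prod>j\<in>UNIV. inverse (x $ j)) * of_int (det ?M)"
    unfolding det_scale_rows_columns det_of_int ..
  finally show ?thesis
    using a xt monomial_eval_nonzero[OF xt]
    by (simp add: r_def torus_def of_int_eq_0_iff_char_dvd)
qed

section \<open>Values, residues and first digits\<close>

lemma val_eq_rval: "x \<noteq> 0 \<Longrightarrow> val x = ereal (rval x)" for x :: "'a::valued_field"
  using val_eq_infinity_iff[of x] val_not_minus_infinity[of x]
  by (cases "val x") (auto simp: rval_def)

lemma rval_1 [simp]: "rval (1 :: 'a::valued_field) = 0"
  by (simp add: rval_def)

lemma rval_minus [simp]: "rval (- x) = rval (x :: 'a::valued_field)"
  by (simp add: rval_def)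

lemma rval_mult: "x \<noteq> 0 \<Longrightarrow> y \<noteq> 0 \<Longrightarrow> rval (x * y) = rval x + rval y"
  for x y :: "'a::valued_field"
  using val_mult[of x y] by (simp add: val_eq_rval)

lemma rval_inverse: "x \<noteq> 0 \<Longrightarrow> rval (inverse x) = - rval x" for x :: "'a::valued_field"
  using rval_mult[of x "inverse x"] by simp

lemma rval_divide: "x \<noteq> 0 \<Longrightarrow> y \<noteq> 0 \<Longrightarrow> rval (x / y) = rval x - rval y"
  for x y :: "'a::valued_field"
  by (simp add: divide_inverse rval_mult rval_inverse)

lemma rval_power: "x \<noteq> 0 \<Longrightarrow> rval (x ^ n) = real n * rval x" for x :: "'a::valued_field"
  by (induction n) (auto simp: rval_mult algebra_simps)

lemma rval_power_int: "x \<noteq> 0 \<Longrightarrow> rval (x powi k) = of_int k * rval x" for x :: "'a::valued_field"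
  by (cases k rule: int_cases2) (auto simp: rval_power power_int_minus rval_inverse)

lemma rval_prod:
  fixes f :: "'b \<Rightarrow> 'a::valued_field"
  shows "(\<And>i. i \<in> A \<Longrightarrow> f i \<noteq> 0) \<Longrightarrow> rval (\<Prod>i\<in>A. f i) = (\<Sum>i\<in>A. rval (f i))"
  by (induction A rule: infinite_finite_induct) (auto simp: rval_mult)

lemma rval_matrix_power_map:
  fixes x :: "'a::valued_field ^ 'n::finite"
  assumes "x \<in> torus"
  shows "rval (matrix_power_map x A $ i) = (\<Sum>j\<in>UNIV. of_int (A $ i $ j) * rval (x $ j))"
  using assms by (simp add: matrix_power_map_nth rval_prod rval_power_int torus_def)

lemma val_add_ge: "c \<le> val x \<Longrightarrow> c \<le> val y \<Longrightarrow> c \<le> val (x + y)" for x y :: "'a::valued_field"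
  using val_add[of x y] by (meson min.boundedI order_trans)

lemma val_add_gt: "c < val x \<Longrightarrow> c < val y \<Longrightarrow> c < val (x + y)" for x y :: "'a::valued_field"
  using val_add[of x y] by (meson min_less_iff_conj less_le_trans)

lemma val_diff_commute: "val (x - y) = val (y - x)" for x y :: "'a::valued_field"
  using val_minus[of "x - y"] by simp

lemma residue_eq_iff:
  assumes "x \<in> val_ring" "y \<in> val_ring"
  shows "residue x = residue y \<longleftrightarrow> x - y \<in> val_ideal"
  using assms Quotient3_rel[OF Quotient3_residue_field, of x y]
  by (auto simp: residue_def residue_rel_def val_ideal_0)

lemma residue_rel_refl: "x \<in> val_ring \<Longrightarrow> residue_rel x x"
  by (simp add: residue_rel_def val_ideal_0)

lemma residue_mult: "x \<in> val_ring \<Longrightarrow> y \<in> val_ring \<Longrightarrow> residue (x * y) = residue x * residue y"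
  by (simp add: residue_def times_residue_field.abs_eq residue_rel_refl)

lemma residue_add: "x \<in> val_ring \<Longrightarrow> y \<in> val_ring \<Longrightarrow> residue (x + y) = residue x + residue y"
  by (simp add: residue_def plus_residue_field.abs_eq residue_rel_refl)

lemma residue_minus: "x \<in> val_ring \<Longrightarrow> residue (- x) = - residue x"
  by (simp add: residue_def uminus_residue_field.abs_eq residue_rel_refl)

lemma residue_0 [simp]: "residue 0 = 0"
  by (simp add: residue_def zero_residue_field_def)

lemma residue_1 [simp]: "residue 1 = 1"
  by (simp add: residue_def one_residue_field_def)

lemma val_ring_0 [simp]: "0 \<in> val_ring" and val_ring_1 [simp]: "1 \<in> val_ring"
  by (simp_all add: val_ring_def)

lemma residue_surj: "\<exists>x\<in>val_ring. residue x = r"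
  using Quotient3_abs_rep[OF Quotient3_residue_field, of r]
    Quotient3_rep_reflp[OF Quotient3_residue_field, of r]
  by (auto simp: residue_def residue_rel_def)

lemma residue_eq_0_iff: "x \<in> val_ring \<Longrightarrow> residue x = 0 \<longleftrightarrow> x \<in> val_ideal"
  using residue_eq_iff[of x 0] by simp

lemma residue_nonzero_iff: "x \<in> val_ring \<Longrightarrow> residue x \<noteq> 0 \<longleftrightarrow> val x = 0"
  by (auto simp: residue_eq_0_iff val_ring_def val_ideal_def)

lemma val_ring_power: "x \<in> val_ring \<Longrightarrow> x ^ n \<in> val_ring"
  by (induction n) (auto intro: val_ring_mult)

lemma residue_power: "x \<in> val_ring \<Longrightarrow> residue (x ^ n) = residue x ^ n"
  by (induction n) (auto simp: residue_mult val_ring_power)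

lemma val_ring_sum: "(\<And>i. i \<in> A \<Longrightarrow> f i \<in> val_ring) \<Longrightarrow> (\<Sum>i\<in>A. f i) \<in> val_ring"
  by (induction A rule: infinite_finite_induct) (auto intro: val_ring_add)

lemma residue_sum:
  "(\<And>i. i \<in> A \<Longrightarrow> f i \<in> val_ring) \<Longrightarrow> residue (\<Sum>i\<in>A. f i) = (\<Sum>i\<in>A. residue (f i))"
  by (induction A rule: infinite_finite_induct) (auto simp: residue_add val_ring_sum)

lemma val_ring_of_nat: "of_nat n \<in> val_ring"
  by (induction n) (auto intro: val_ring_add)

lemma residue_of_nat: "residue (of_nat n) = of_nat n"
  by (induction n) (auto simp: residue_add val_ring_of_nat)

text \<open>Nontriviality provides an element of positive value, so the maximal ideal and its generator
  are nonzero; every element of the ideal is a multiple of the generator by an integral element.\<close>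
lemma uniformizer_minimal:
  fixes \<pi> :: "'a::discrete_valued_field"
  assumes "uniformizer \<pi>"
  shows "\<pi> \<noteq> 0" "0 < rval \<pi>" "\<And>x::'a. 0 < val x \<Longrightarrow> val \<pi> \<le> val x"
proof -
  obtain x :: 'a where x: "x \<noteq> 0" "val x \<noteq> 0" using val_nontrivial by blast
  have "0 < val x \<or> 0 < val (inverse x)" "inverse x \<noteq> 0"
    using x by (auto simp: val_eq_rval rval_inverse)
  then obtain y :: 'a where "y \<noteq> 0" "y \<in> val_ideal" using x
    by (metis inverse_nonzero_iff_nonzero mem_Collect_eq val_ideal_def)
  then show nz: "\<pi> \<noteq> 0" using assms by (auto simp: uniformizer_def)
  have "\<pi> * 1 \<in> val_ideal" unfolding assms[unfolded uniformizer_def] by (rule imageI) simp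
  then show "0 < rval \<pi>" using nz by (simp add: val_ideal_def val_eq_rval)
  show "val \<pi> \<le> val z" if z: "0 < val z" for z :: 'a
  proof -
    have "z \<in> (\<lambda>x. \<pi> * x) ` val_ring"
      using z assms by (simp add: val_ideal_def uniformizer_def flip: assms[unfolded uniformizer_def])
    then show ?thesis
      by (auto simp: val_mult val_ring_def intro: add_increasing2)
  qed
qed

text \<open>Divide by the largest power of the uniformizer: the remaining value lies strictly below
  that of the uniformizer, hence is zero.\<close>
lemma rval_eq_int_multiple:
  fixes \<pi> x :: "'a::discrete_valued_field"
  assumes \<pi>: "uniformizer \<pi>" and x: "x \<noteq> 0"
  shows "rval x = rval \<pi> * of_int \<lfloor>rval x / rval \<pi>\<rfloor>"
proof -
  note u = uniformizer_minimal[OF \<pi>]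
  let ?m = "\<lfloor>rval x / rval \<pi>\<rfloor>"
  let ?y = "\<pi> powi (- ?m) * x"
  have y: "rval ?y = rval x - rval \<pi> * of_int ?m" "?y \<noteq> 0"
    using u x by (auto simp: rval_mult rval_power_int)
  have "rval \<pi> * of_int ?m \<le> rval x"
    using u pos_le_divide_eq[of "rval \<pi>" "of_int ?m" "rval x"] by (simp add: mult.commute)
  moreover have "rval x < rval \<pi> * (of_int ?m + 1)"
    using u floor_correct[of "rval x / rval \<pi>"] by (simp add: field_simps)
  ultimately have "0 \<le> rval ?y" "rval ?y < rval \<pi>"
    using y by (auto simp: algebra_simps)
  then have "rval ?y = 0" using u(3)[of ?y] u(1) y(2) by (force simp: val_eq_rval)
  with y show ?thesis by simp
qed

text \<open>This replaces the floor in the definition of the first digit by any integer known to be the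
  order of \<open>x\<close>.\<close>
lemma first_digit_eq_residue:
  fixes \<pi> x :: "'a::discrete_valued_field"
  assumes "uniformizer \<pi>" and "x \<noteq> 0" and "rval x = rval \<pi> * of_int m"
  shows "first_digit \<pi> x = residue (\<pi> powi (- m) * x)" and "val (\<pi> powi (- m) * x) = 0"
  using uniformizer_minimal[OF assms(1)] assms(2,3)
  by (auto simp: first_digit_def val_eq_rval rval_mult rval_power_int)

lemma first_digit_mult:
  fixes \<pi> x y :: "'a::discrete_valued_field"
  assumes \<pi>: "uniformizer \<pi>" and x: "x \<noteq> 0" and y: "y \<noteq> 0"
  shows "first_digit \<pi> (x * y) = first_digit \<pi> x * first_digit \<pi> y"
proof -
  obtain m k :: int where m: "rval x = rval \<pi> * of_int m" and k: "rval y = rval \<pi> * of_int k"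
    using rval_eq_int_multiple[OF \<pi>] x y by metis
  have mk: "rval (x * y) = rval \<pi> * of_int (m + k)"
    using x y m k by (simp add: rval_mult algebra_simps)
  have nz: "\<pi> \<noteq> 0" using uniformizer_minimal[OF \<pi>] by simp
  have "\<pi> powi (- (m + k)) * (x * y) = (\<pi> powi (- m) * x) * (\<pi> powi (- k) * y)"
    using nz by (simp add: power_int_add power_int_diff power_int_minus field_simps)
  moreover have "\<pi> powi (- m) * x \<in> val_ring" "\<pi> powi (- k) * y \<in> val_ring"
    using first_digit_eq_residue(2)[OF \<pi> x m] first_digit_eq_residue(2)[OF \<pi> y k]
    by (simp_all add: val_ring_def)
  ultimately show ?thesis
    using first_digit_eq_residue(1)[OF \<pi> _ mk] x y
    unfolding first_digit_eq_residue(1)[OF \<pi> x m] first_digit_eq_residue(1)[OF \<pi> y k]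
    by (metis mult_eq_0_iff residue_mult)
qed

lemma first_digit_nonzero:
  fixes \<pi> x :: "'a::discrete_valued_field"
  assumes "uniformizer \<pi>" "x \<noteq> 0"
  shows "first_digit \<pi> x \<noteq> 0"
  using first_digit_eq_residue[OF assms rval_eq_int_multiple[OF assms]]
  by (simp add: residue_nonzero_iff val_ring_def)

lemma first_digit_of_unit:
  fixes \<pi> x :: "'a::discrete_valued_field"
  assumes "uniformizer \<pi>" "val x = 0"
  shows "first_digit \<pi> x = residue x"
proof -
  have "x \<noteq> 0" using assms by auto
  then show ?thesis using assms first_digit_eq_residue(1)[of \<pi> x 0] by (simp add: val_eq_rval)
qed

lemma first_digit_uniformizer: "uniformizer \<pi> \<Longrightarrow> first_digit \<pi> \<pi> = 1"
  for \<pi> :: "'a::discrete_valued_field"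
  using first_digit_eq_residue(1)[of \<pi> \<pi> 1] uniformizer_minimal(1)[of \<pi>]
  by (simp add: power_int_minus)

lemma first_digit_1: "uniformizer \<pi> \<Longrightarrow> first_digit \<pi> 1 = 1"
  for \<pi> :: "'a::discrete_valued_field"
  by (simp add: first_digit_of_unit)

lemma first_digit_minus: "uniformizer \<pi> \<Longrightarrow> x \<noteq> 0 \<Longrightarrow> first_digit \<pi> (- x) = - first_digit \<pi> x"
  for \<pi> :: "'a::discrete_valued_field"
  using first_digit_mult[of \<pi> "-1" x] first_digit_of_unit[of \<pi> "- 1"]
  by (simp add: residue_minus)

lemma first_digit_inverse:
  "uniformizer \<pi> \<Longrightarrow> x \<noteq> 0 \<Longrightarrow> first_digit \<pi> (inverse x) = inverse (first_digit \<pi> x)"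
  for \<pi> :: "'a::discrete_valued_field"
  using first_digit_mult[of \<pi> x "inverse x"] first_digit_1[of \<pi>] inverse_unique[of "first_digit \<pi> x"]
  by simp

lemma first_digit_divide:
  "uniformizer \<pi> \<Longrightarrow> x \<noteq> 0 \<Longrightarrow> y \<noteq> 0 \<Longrightarrow>
    first_digit \<pi> (x / y) = first_digit \<pi> x / first_digit \<pi> y"
  for \<pi> :: "'a::discrete_valued_field"
  by (simp add: divide_inverse first_digit_mult first_digit_inverse)

lemma first_digit_power: "uniformizer \<pi> \<Longrightarrow> x \<noteq> 0 \<Longrightarrow> first_digit \<pi> (x ^ n) = first_digit \<pi> x ^ n"
  for \<pi> :: "'a::discrete_valued_field"
  by (induction n) (auto simp: first_digit_1 first_digit_mult)

lemma first_digit_power_int: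
  "uniformizer \<pi> \<Longrightarrow> x \<noteq> 0 \<Longrightarrow> first_digit \<pi> (x powi k) = first_digit \<pi> x powi k"
  for \<pi> :: "'a::discrete_valued_field"
  by (cases k rule: int_cases2)
    (auto simp: first_digit_power power_int_minus first_digit_inverse)

lemma first_digit_prod:
  fixes \<pi> :: "'a::discrete_valued_field"
  assumes "uniformizer \<pi>"
  shows "(\<And>i. i \<in> A \<Longrightarrow> f i \<noteq> 0) \<Longrightarrow> first_digit \<pi> (\<Prod>i\<in>A. f i) = (\<Prod>i\<in>A. first_digit \<pi> (f i))"
  by (induction A rule: infinite_finite_induct)
    (use assms in \<open>auto simp: first_digit_1 first_digit_mult\<close>)

text \<open>The first digit is a group homomorphism, so it commutes with monomial maps.\<close>
lemma first_digit_matrix_power_map: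
  fixes \<pi> :: "'a::discrete_valued_field" and x :: "'a ^ 'n::finite"
  assumes "uniformizer \<pi>" "x \<in> torus"
  shows "matrix_power_map (\<chi> j. first_digit \<pi> (x $ j)) A $ i = first_digit \<pi> (matrix_power_map x A $ i)"
  using assms by (simp add: matrix_power_map_nth first_digit_prod first_digit_power_int torus_def)

section \<open>Roots of prescribed first digit\<close>

lemma finite_roots:
  fixes e :: "'a::field"
  assumes "0 < n"
  shows "finite {y. y ^ n = e}"
proof -
  have "monom 1 n - [:e:] \<noteq> 0"
  proof
    assume "monom 1 n - [:e:] = 0"
    then have "degree (monom (1::'a) n) = degree [:e:]" by simp
    then show False using assms by (simp add: degree_monom_eq)
  qed
  then have "finite {y. poly (monom 1 n - [:e:]) y = 0}" by (rule poly_roots_finite)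
  then show ?thesis by (simp add: poly_monom)
qed

lemma card_roots_eq_card_roots_of_unity:
  fixes e :: "'a::field"
  assumes "y \<noteq> 0" "y ^ n = e"
  shows "card {z. z \<noteq> 0 \<and> z ^ n = e} = card {z::'a. z \<noteq> 0 \<and> z ^ n = 1}"
proof -
  have "bij_betw (\<lambda>z. z / y) {z. z \<noteq> 0 \<and> z ^ n = e} {z. z \<noteq> 0 \<and> z ^ n = 1}"
    by (rule bij_betw_byWitness[where f' = "\<lambda>z. z * y"])
      (use assms in \<open>auto simp: power_divide power_mult_distrib\<close>)
  then show ?thesis by (rule bij_betw_same_card)
qed

lemma residue_geometric_sum:
  assumes "x \<in> val_ring" "y \<in> val_ring" "residue x = 1" "residue y = 1"
  shows "(\<Sum>p<n. x ^ p * y ^ (m - p)) \<in> val_ring"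
    and "residue (\<Sum>p<n. x ^ p * y ^ (m - p)) = of_nat n"
  using assms
  by (auto intro!: val_ring_sum val_ring_mult val_ring_power
      simp: residue_sum residue_mult residue_power val_ring_mult val_ring_power)

lemma residue_eq_1I:
  assumes "y - 1 \<in> val_ideal"
  shows "y \<in> val_ring" "residue y = 1"
proof -
  have "(y - 1) + 1 \<in> val_ring"
    using assms by (intro val_ring_add) (auto simp: val_ring_def val_ideal_def)
  then show "y \<in> val_ring" by simp
  then show "residue y = 1" using assms residue_eq_iff[of y 1] by simp
qed

text \<open>The difference quotient of the \<open>n\<close>-th power is a sum of \<open>n\<close> products, each with residue \<open>1\<close>.
  It is therefore a unit when the residue characteristic does not divide \<open>n\<close>; both the existence
  and the uniqueness of roots below rest on this.\<close>
lemma power_diff_quotient_near_1: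
  fixes x y :: "'a::valued_field"
  assumes n: "of_nat n \<noteq> (0 :: 'a residue_field)"
    and x: "x - 1 \<in> val_ideal" and y: "y - 1 \<in> val_ideal"
  obtains S where "x ^ n - y ^ n = (x - y) * S" "S \<in> val_ring" "residue S = of_nat n"
proof -
  obtain k where k: "n = Suc k" using n by (cases n) auto
  show ?thesis
    using residue_eq_1I[OF x] residue_eq_1I[OF y]
    by (intro that[of "\<Sum>p<Suc k. x ^ p * y ^ (k - p)"])
      (simp_all only: k diff_power_eq_sum residue_geometric_sum)
qed

lemma ereal_real_less_imp_infinity: "(\<And>C. ereal C < x) \<Longrightarrow> x = \<infinity>"
  by (metis ereal_top less_imp_le)

text \<open>The fixed point theorem of Banach on the closed set \<open>x + val_ideal\<close>. The iterates started at
  \<open>x\<close> satisfy \<open>val (s (n + k) - s n) \<ge> n * r\<close>, and the ultrametric inequality turns this into the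
  Cauchy property.\<close>
lemma complete_contraction_fixed_point:
  fixes \<phi> :: "'a::complete_discrete_valued_field \<Rightarrow> 'a" and r :: real
  assumes r: "0 < r"
    and maps: "\<And>y. y - x \<in> val_ideal \<Longrightarrow> \<phi> y - x \<in> val_ideal"
    and contr: "\<And>y z. y - x \<in> val_ideal \<Longrightarrow> z - x \<in> val_ideal \<Longrightarrow>
      val (y - z) + ereal r \<le> val (\<phi> y - \<phi> z)"
  obtains l where "l - x \<in> val_ideal" "\<phi> l = l"
proof -
  define s where "s n = (\<phi> ^^ n) x" for n
  have s_Suc: "s (Suc n) = \<phi> (s n)" for n by (simp add: s_def)
  have s_near: "s n - x \<in> val_ideal" for n
    by (induction n) (auto simp: s_Suc maps, simp add: s_def val_ideal_0)
  have step: "ereal (real n * r) \<le> val (s (n + k) - s n)" for n k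
  proof (induction n)
    case 0
    show ?case using s_near[of k] by (simp add: s_def val_ideal_def less_imp_le flip: zero_ereal_def)
  next
    case (Suc n)
    have "ereal (real (Suc n) * r) = ereal (real n * r) + ereal r" by (simp add: algebra_simps)
    also have "\<dots> \<le> val (s (n + k) - s n) + ereal r" by (intro add_right_mono Suc.IH)
    also have "\<dots> \<le> val (s (Suc n + k) - s (Suc n))"
      using contr[OF s_near s_near] by (simp add: s_Suc)
    finally show ?case .
  qed
  have "\<exists>N. \<forall>m\<ge>N. \<forall>n\<ge>N. ereal C < val (s m - s n)" for C
  proof -
    obtain N where N: "C < real N * r" using reals_Archimedean3[OF r] by blast
    have "ereal C < val (s m - s n)" if "N \<le> m" "N \<le> n" for m n
    proof -
      have ge: "ereal (real N * r) \<le> val (s m - s N)" "ereal (real N * r) \<le> val (s N - s n)"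
        using that step[of N "m - N"] step[of N "n - N"] by (simp_all add: val_diff_commute[of "s N"])
      have "ereal (real N * r) \<le> val ((s m - s N) + (s N - s n))"
        by (intro val_add_ge ge)
      with N show ?thesis by (simp add: less_le_trans[of "ereal C" "ereal (real N * r)"])
    qed
    then show ?thesis by blast
  qed
  then obtain l where l: "\<And>C. \<exists>N. \<forall>n\<ge>N. ereal C < val (s n - l)"
    using val_complete[of s] by blast
  have near: "l - x \<in> val_ideal"
  proof -
    obtain N where N: "\<forall>n\<ge>N. ereal 0 < val (s n - l)" using l by blast
    then have "l - s N \<in> val_ideal"
      by (simp add: val_ideal_def val_diff_commute[of l] zero_ereal_def)
    from val_ideal_add[OF this s_near[of N]] show ?thesis by simp
  qed
  have "ereal C < val (\<phi> l - l)" for C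
  proof -
    obtain N where N: "\<forall>n\<ge>N. ereal C < val (s n - l)" using l by blast
    have "ereal C < val (l - s N)" using N by (simp add: val_diff_commute[of l])
    also have "\<dots> \<le> val (l - s N) + ereal r" using r by (simp add: add_increasing2)
    also have "\<dots> \<le> val (\<phi> l - s (Suc N))" using contr[OF near s_near] by (simp add: s_Suc)
    finally have "ereal C < val ((\<phi> l - s (Suc N)) + (s (Suc N) - l))"
      using N by (intro val_add_gt) auto
    then show ?thesis by simp
  qed
  then have "\<phi> l - l = 0" using ereal_real_less_imp_infinity val_eq_infinity_iff by blast
  then show ?thesis using that near by simp
qed

text \<open>Hensel's lemma for pure powers, near \<open>1\<close>. Newton iteration for \<open>Y ^ n - u\<close> with the
  derivative frozen at its value \<open>n\<close> at the point \<open>1\<close> is \<open>\<phi> y = y - (y ^ n - u) / n\<close>. Near \<open>1\<close>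
  the difference quotient of \<open>Y ^ n\<close> is congruent to \<open>n\<close>, so \<open>\<phi>\<close> raises the value of differences
  by at least the value of the uniformizer.\<close>
lemma root_of_one_unit:
  fixes u :: "'a::complete_discrete_valued_field"
  assumes \<pi>: "uniformizer (\<pi> :: 'a)" and n: "of_nat n \<noteq> (0 :: 'a residue_field)"
    and u: "u - 1 \<in> val_ideal"
  obtains y where "y - 1 \<in> val_ideal" "y ^ n = u"
proof -
  define N where "N = (of_nat n :: 'a)"
  define \<phi> where "\<phi> y = y - (y ^ n - u) / N" for y
  have N: "val N = 0"
    using n residue_nonzero_iff[of N] by (simp add: N_def val_ring_of_nat residue_of_nat)
  then have N0: "N \<noteq> 0" by auto
  have inv: "val (inverse N) = 0" using N by (rule val_inverse_unit)
  have contr: "val (y - z) + ereal (rval \<pi>) \<le> val (\<phi> y - \<phi> z)"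
    if yz: "y - 1 \<in> val_ideal" "z - 1 \<in> val_ideal" for y z
  proof -
    obtain S where S: "y ^ n - z ^ n = (y - z) * S" "S \<in> val_ring" "residue S = of_nat n"
      using power_diff_quotient_near_1[OF n yz] .
    have "\<phi> y - \<phi> z = (y - z) - (y ^ n - z ^ n) * inverse N"
      by (simp add: \<phi>_def divide_inverse algebra_simps)
    also have "\<dots> = (y - z) * (inverse N * (N - S))"
      unfolding S(1) using N0 by (simp add: algebra_simps)
    finally have eq: "\<phi> y - \<phi> z = (y - z) * (inverse N * (N - S))" .
    have "N - S \<in> val_ideal"
      using S residue_eq_iff[of N S] by (simp add: N_def val_ring_of_nat residue_of_nat)
    then have "ereal (rval \<pi>) \<le> val (inverse N * (N - S))"
      using uniformizer_minimal[OF \<pi>] inv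
      by (simp add: val_mult val_ideal_def flip: val_eq_rval)
    then show ?thesis unfolding eq val_mult[of "y - z"] by (rule add_left_mono)
  qed
  have maps: "\<phi> y - 1 \<in> val_ideal" if y: "y - 1 \<in> val_ideal" for y
  proof -
    note r = residue_eq_1I[OF y] residue_eq_1I[OF u]
    have "y ^ n - u \<in> val_ideal"
      using r residue_eq_iff[of "y ^ n" u] by (simp add: val_ring_power residue_power)
    then have "inverse N * (y ^ n - u) \<in> val_ideal"
      by (intro val_ideal_mult) (simp add: val_ring_def inv)
    from val_ideal_add[OF y val_ideal_minus[OF this]] show ?thesis
      by (simp add: \<phi>_def divide_inverse algebra_simps)
  qed
  obtain l where "l - 1 \<in> val_ideal" "\<phi> l = l"
    using complete_contraction_fixed_point[of "rval \<pi>" 1 \<phi>, OF _ maps contr]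
      uniformizer_minimal(2)[OF \<pi>] by blast
  then show ?thesis using that N0 by (simp add: \<phi>_def)
qed

text \<open>The hypothesis on the value of \<open>e\<close> makes \<open>e\<close> an \<open>n\<close>-th power up to a unit. Two roots with the
  same first digit differ by a root of unity with residue \<open>1\<close>, and \<open>1\<close> is the only one when \<open>n\<close>
  is invertible in the residue field. Conversely, a root \<open>\<eta>\<close> of the first digit is lifted to some
  \<open>z\<close> of the right value, which is a root up to a factor with residue \<open>1\<close>; that factor has an
  \<open>n\<close>-th root with residue \<open>1\<close>.\<close>
lemma bij_betw_first_digit_roots:
  fixes e :: "'a::complete_discrete_valued_field"
  assumes \<pi>: "uniformizer \<pi>" and n: "of_nat n \<noteq> (0 :: 'a residue_field)"
    and e: "e \<noteq> 0" and rval_e: "rval e = real n * (rval \<pi> * of_int m)"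
  shows "bij_betw (first_digit \<pi>) {y. y \<noteq> 0 \<and> y ^ n = e}
           {\<eta>. \<eta> \<noteq> 0 \<and> \<eta> ^ n = first_digit \<pi> e}" (is "bij_betw _ ?X ?Y")
proof (rule bij_betw_imageI)
  have n0: "0 < n" using n by (cases n) auto
  have \<pi>0: "\<pi> \<noteq> 0" using uniformizer_minimal[OF \<pi>] by simp
  show "inj_on (first_digit \<pi>) ?X"
  proof (rule inj_onI)
    fix y z assume y: "y \<in> ?X" and z: "z \<in> ?X" and eq: "first_digit \<pi> y = first_digit \<pi> z"
    let ?\<zeta> = "y / z"
    have pow: "?\<zeta> ^ n = 1" "?\<zeta> \<noteq> 0" using y z e by (auto simp: power_divide)
    then have "real n * rval ?\<zeta> = 0" using rval_power[of ?\<zeta> n] by simp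
    then have val: "val ?\<zeta> = 0" using n0 pow val_eq_rval[of ?\<zeta>] by simp
    have "first_digit \<pi> ?\<zeta> = 1" using y z eq \<pi> by (simp add: first_digit_divide first_digit_nonzero)
    then have "residue ?\<zeta> = 1" using first_digit_of_unit[OF \<pi> val] by simp
    then have near: "?\<zeta> - 1 \<in> val_ideal"
      using residue_eq_iff[of ?\<zeta> 1] val by (simp add: val_ring_def)
    have one: "(1::'a) - 1 \<in> val_ideal" by (simp add: val_ideal_0)
    obtain S where S: "?\<zeta> ^ n - 1 ^ n = (?\<zeta> - 1) * S" "residue S = of_nat n"
      using power_diff_quotient_near_1[OF n near one] by metis
    have "S \<noteq> 0" using S(2) n by auto
    then show "y = z" using S(1) pow z by simp
  qed
  show "first_digit \<pi> ` ?X = ?Y"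
  proof (intro equalityI subsetI)
    fix \<eta> assume "\<eta> \<in> first_digit \<pi> ` ?X"
    then show "\<eta> \<in> ?Y" using \<pi> by (auto simp: first_digit_nonzero simp flip: first_digit_power)
  next
    fix \<eta> assume \<eta>: "\<eta> \<in> ?Y"
    obtain x where x: "x \<in> val_ring" "residue x = \<eta>" using residue_surj by blast
    then have val_x: "val x = 0" using \<eta> residue_nonzero_iff by auto
    then have x0: "x \<noteq> 0" by auto
    define z where "z = \<pi> powi m * x"
    have z0: "z \<noteq> 0" using x0 \<pi>0 by (simp add: z_def)
    have fz: "first_digit \<pi> z = \<eta>"
      using \<pi> \<pi>0 x0 x val_x by (simp add: z_def first_digit_mult first_digit_power_int
          first_digit_uniformizer first_digit_of_unit)
    have rz: "rval z = rval \<pi> * of_int m"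
      using x0 \<pi>0 val_x by (simp add: z_def rval_mult rval_power_int val_eq_rval)
    let ?u = "e / z ^ n"
    have "rval ?u = 0" using e z0 rz rval_e by (simp add: rval_divide rval_power)
    then have val_u: "val ?u = 0" using e z0 by (simp add: val_eq_rval)
    have "first_digit \<pi> ?u = 1"
      using \<eta> e z0 fz first_digit_nonzero[OF \<pi> e]
      by (simp add: first_digit_divide[OF \<pi>] first_digit_power[OF \<pi>])
    then have "residue ?u = 1" using first_digit_of_unit[OF \<pi> val_u] by simp
    then have "?u - 1 \<in> val_ideal"
      using residue_eq_iff[of ?u 1] val_u by (simp add: val_ring_def)
    then obtain y where y: "y - 1 \<in> val_ideal" "y ^ n = ?u"
      using root_of_one_unit[OF \<pi> n] by blast
    note ry = residue_eq_1I[OF y(1)]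
    have val_y: "val y = 0" using ry residue_nonzero_iff[of y] by simp
    then have y0: "y \<noteq> 0" by auto
    have "(y * z) ^ n = e" using y z0 by (simp add: power_mult_distrib)
    moreover have "first_digit \<pi> (y * z) = \<eta>"
      using \<pi> y0 z0 fz ry first_digit_of_unit[OF \<pi> val_y] by (simp add: first_digit_mult)
    ultimately show "\<eta> \<in> first_digit \<pi> ` ?X" using y0 z0 by force
  qed
qed

section \<open>Tropical hypersurface and initial form of a binomial\<close>

lemma trop_fun_two_terms:
  assumes "Poly_Mapping.keys f = {\<gamma>, \<gamma>'}"
  shows "trop_fun f w = min (trop_weight f w \<gamma>) (trop_weight f w \<gamma>')"
  using assms by (simp add: trop_fun_def)

text \<open>The line minus \<open>g\<close> has a minimum at \<open>0\<close>, so its derivative vanishes there.\<close>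
lemma differentiable_touching_line_slope:
  fixes g :: "real \<Rightarrow> real"
  assumes "(g has_real_derivative D) (at 0)" and "\<And>t. g t \<le> g 0 + t * m"
  shows "D = m"
proof -
  have "((\<lambda>t. g 0 + t * m - g t) has_real_derivative m - D) (at 0)"
    by (auto intro!: derivative_eq_intros assms(1))
  then have "m - D = 0"
    by (rule DERIV_local_min[where d = 1]) (use assms(2) in auto)
  then show ?thesis by simp
qed

text \<open>Along the direction \<open>v = \<gamma> - \<gamma>'\<close>, both terms are lines that lie above the minimum and meet it at
  \<open>w\<close>. If the minimum were differentiable, both lines would have its slope there; but their slopes
  differ by \<open>v \<bullet> v > 0\<close>.\<close>
lemma mem_Trop_two_terms:
  fixes f :: "('a::valued_field, 'n::finite) laurent"
  assumes keys: "Poly_Mapping.keys f = {\<gamma>, \<gamma>'}" and ne: "\<gamma> \<noteq> \<gamma>'"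
    and tie: "trop_weight f w \<gamma> = trop_weight f w \<gamma>'"
  shows "w \<in> Trop f"
proof (rule ccontr)
  assume "w \<notin> Trop f"
  then have diff: "trop_fun f differentiable (at w)" by (simp add: Trop_def)
  define R where "R \<epsilon> = (\<chi> j. real_of_int (\<epsilon> $ j))" for \<epsilon> :: "int ^ 'n"
  define v where "v = R \<gamma> - R \<gamma>'"
  define g where "g t = trop_fun f (w + t *\<^sub>R v)" for t
  have "(\<lambda>t::real. trop_fun f (w + t *\<^sub>R v)) differentiable (at 0)"
    by (rule differentiable_compose[of "trop_fun f" "\<lambda>t. w + t *\<^sub>R v"])
      (use diff in \<open>auto intro!: derivative_intros\<close>)
  then obtain D where D: "(g has_real_derivative D) (at 0)"
    by (auto simp: g_def[abs_def] real_differentiable_def)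
  have g0: "g 0 = trop_weight f w \<gamma>" "g 0 = trop_weight f w \<gamma>'"
    using tie by (simp_all add: g_def trop_fun_two_terms[OF keys])
  have weight: "trop_weight f (w + t *\<^sub>R v) \<epsilon> = trop_weight f w \<epsilon> + t * (R \<epsilon> \<bullet> v)" for t \<epsilon>
    by (simp add: trop_weight_def R_def inner_add_right)
  have "D = R \<gamma> \<bullet> v"
    by (rule differentiable_touching_line_slope[OF D])
      (simp only: g0(1), simp add: g_def trop_fun_two_terms[OF keys] weight)
  moreover have "D = R \<gamma>' \<bullet> v"
    by (rule differentiable_touching_line_slope[OF D])
      (simp only: g0(2), simp add: g_def trop_fun_two_terms[OF keys] weight)
  ultimately have "v \<bullet> v = 0" by (simp add: v_def inner_diff_left)
  then have "R \<gamma> = R \<gamma>'" by (simp add: v_def)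
  with ne show False by (simp add: R_def vec_eq_iff)
qed

lemma initial_form_binomial:
  fixes \<pi> :: "'a::discrete_valued_field"
  assumes \<pi>: "uniformizer \<pi>" and ne: "\<gamma> \<noteq> \<gamma>'" and nz: "c \<noteq> 0" "e \<noteq> 0"
    and tie: "rval c + (\<chi> j. real_of_int (\<gamma> $ j)) \<bullet> w = rval e + (\<chi> j. real_of_int (\<gamma>' $ j)) \<bullet> w"
  defines "f \<equiv> Poly_Mapping.single \<gamma> c - Poly_Mapping.single \<gamma>' e"
  shows "w \<in> Trop f"
    and "initial_form \<pi> w f =
      Poly_Mapping.single \<gamma> (first_digit \<pi> c) - Poly_Mapping.single \<gamma>' (first_digit \<pi> e)"
proof -
  have keys: "Poly_Mapping.keys f = {\<gamma>, \<gamma>'}"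
    unfolding f_def using keys_binomial[OF ne nz] .
  have lookup: "Poly_Mapping.lookup f \<gamma> = c" "Poly_Mapping.lookup f \<gamma>' = - e"
    using ne by (auto simp: f_def lookup_minus lookup_single)
  have weight: "trop_weight f w \<gamma> = trop_weight f w \<gamma>'"
    using tie by (simp add: trop_weight_def lookup)
  show "w \<in> Trop f" by (rule mem_Trop_two_terms[OF keys ne weight])
  have "{\<epsilon>. \<epsilon> \<in> Poly_Mapping.keys f \<and> trop_weight f w \<epsilon> = trop_fun f w} = {\<gamma>, \<gamma>'}"
    using weight by (auto simp: keys trop_fun_two_terms[OF keys])
  then show "initial_form \<pi> w f =
      Poly_Mapping.single \<gamma> (first_digit \<pi> c) - Poly_Mapping.single \<gamma>' (first_digit \<pi> e)"
    using ne nz \<pi> by (simp add: initial_form_def lookup first_digit_minus single_uminus)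
qed

section \<open>Semiregularity and the number of zeros\<close>

lemma det_smith_normal_form:
  assumes "smith_normal_form M P d Q"
  shows "det M = det P * (\<Prod>i\<in>UNIV. int (d i)) * det Q"
proof -
  have M: "M = P ** (\<chi> i j. if i = j then int (d i) else 0) ** Q"
    using assms by (simp add: smith_normal_form_def)
  show ?thesis unfolding M by (simp add: det_mul det_diagonal)
qed

theorem proposition4p4:
  fixes \<pi> :: "'a::complete_discrete_valued_field"
    and a b :: "('a, 'n::{finite,linorder}) vec"
    and \<alpha> \<beta> M P Q :: "((int, 'n) vec, 'n) vec"
    and d :: "'n \<Rightarrow> nat"
    and B :: "(('a, 'n) laurent, 'n) vec"
    and w :: "(real, 'n) vec"
  assumes "uniformizer \<pi>"
    and "a \<in> torus" and "b \<in> torus"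
    and "B = binomial_system a b \<alpha> \<beta>"
    and "M = (\<chi> i. \<alpha> $ i - \<beta> $ i)"
    and "det M \<noteq> 0"
    and "smith_normal_form M P d Q"
    and "w = matrix_inv (\<chi> i j. real_of_int (M $ i $ j)) *v (\<chi> i. rval (b $ i) - rval (a $ i))"
  shows
    "let c1 = (w \<notin> value_lattice \<pi>);
         c2 = (\<not> int CHAR('a residue_field) dvd det M);
         c3 = (\<exists>i. \<not> (\<exists>y::'a residue_field. y \<noteq> 0 \<and>
                 y ^ d i = matrix_power_map (\<chi> j. first_digit \<pi> (b $ j / a $ j)) (matrix_inv P) $ i))
     in (semiregular \<pi> B w \<longleftrightarrow> c1 \<or> c2 \<or> c3) \<and>
        (semiregular \<pi> B w \<longrightarrow>
          (if \<not> c1 \<and> \<not> c3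
           then finite (torus_zeros B) \<and>
                card (torus_zeros B) = (\<Prod>i\<in>UNIV. card {\<xi>::'a residue_field. \<xi> \<noteq> 0 \<and> \<xi> ^ d i = 1})
           else torus_zeros B = {}))"
proof -
  note \<pi> = assms(1) and a = assms(2) and b = assms(3) and B = assms(4) and M = assms(5)
    and snf = assms(7)
  have nz: "a $ i \<noteq> 0" "b $ i \<noteq> 0" for i using a b by (auto simp: torus_def)
  have rows: "\<alpha> $ i \<noteq> \<beta> $ i" for i
  proof
    assume "\<alpha> $ i = \<beta> $ i"
    then have "row i M = 0" by (simp add: M row_def vec_eq_iff)
    then show False using det_zero_row(1)[of i M] assms(6) by simp
  qed
  have d: "0 < d i" for i using snf by (simp add: smith_normal_form_def)

  \<comment> \<open>The point \<open>w\<close> is the unique solution of \<open>M w = v(b) - v(a)\<close>. This ties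
    the two terms of each binomial at \<open>w\<close> and determines the value of any zero.\<close>
  let ?R = "(\<chi> i j. real_of_int (M $ i $ j)) :: ((real, 'n) vec, 'n) vec"
  have "det ?R \<noteq> 0" using assms(6) by (simp add: det_of_int)
  then have inv: "invertible ?R" by (simp add: invertible_det_nz)
  have w_iff: "(\<forall>i. (\<Sum>j\<in>UNIV. of_int (M $ i $ j) * x $ j) = rval (b $ i) - rval (a $ i)) \<longleftrightarrow> x = w"
    for x :: "(real, 'n) vec"
  proof -
    have "?R *v w = (\<chi> i. rval (b $ i) - rval (a $ i))"
      using matrix_inv_inverse[OF inv] by (simp add: assms(8) matrix_vector_mul_assoc)
    moreover have "?R *v x = ?R *v w \<longleftrightarrow> x = w"
      using inj_matrix_vector_mult[OF inv] by (auto dest: injD)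
    ultimately show ?thesis by (simp add: vec_eq_iff matrix_vector_mult_def)
  qed

  define c where "c = (\<chi> j. b $ j / a $ j)"
  define \<delta>c where "\<delta>c = (\<chi> j. first_digit \<pi> (b $ j / a $ j))"
  define e where "e = matrix_power_map c (matrix_inv P)"
  define \<epsilon> where "\<epsilon> = matrix_power_map \<delta>c (matrix_inv P)"
  have c: "c \<in> torus" using nz by (simp add: c_def torus_def)
  have \<delta>c: "\<delta>c \<in> torus" using nz first_digit_nonzero[OF \<pi>] by (simp add: \<delta>c_def torus_def)
  have \<epsilon>_e: "\<epsilon> $ i = first_digit \<pi> (e $ i)" for i
    using first_digit_matrix_power_map[OF \<pi> c, of "matrix_inv P" i]
    by (simp add: \<epsilon>_def e_def \<delta>c_def c_def)
  have e_nz: "e $ i \<noteq> 0" for i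
    using matrix_power_map_in_torus[OF c] by (simp add: e_def torus_def)

  \<comment> \<open>The decoupled equations: \<open>S\<close> over the valued field, \<open>T\<close> over the residue field.\<close>
  define S where "S i = {y. y \<noteq> 0 \<and> y ^ d i = e $ i}" for i
  define T where "T i = {\<eta>. \<eta> \<noteq> 0 \<and> \<eta> ^ d i = \<epsilon> $ i}" for i
  have zeros_B: "torus_zeros B = {x \<in> torus. matrix_power_map x M = c}"
    unfolding B torus_zeros_binomial_system[OF a b] M c_def ..
  have bij_B: "bij_betw (\<lambda>x. matrix_power_map x Q) (torus_zeros B) {y. \<forall>i. y $ i \<in> S i}"
    using bij_betw_monomial_solutions[OF snf c] by (simp add: zeros_B S_def e_def)
  have bij_init: "bij_betw (\<lambda>x. matrix_power_map x Q) {x \<in> torus. matrix_power_map x M = \<delta>c}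
      {y. \<forall>i. y $ i \<in> T i}"
    using bij_betw_monomial_solutions[OF snf \<delta>c] by (simp add: T_def \<epsilon>_def)
  have digit_S: "first_digit \<pi> y \<in> T i" if "y \<in> S i" for y i
    using that first_digit_nonzero[OF \<pi>] first_digit_power[OF \<pi>, of y "d i"]
    by (simp add: S_def T_def \<epsilon>_e)

  define c1 where "c1 \<longleftrightarrow> w \<notin> value_lattice \<pi>"
  define c2 where "c2 \<longleftrightarrow> \<not> int CHAR('a residue_field) dvd det M"
  define c3 where "c3 \<longleftrightarrow> (\<exists>i. T i = {})"

  \<comment> \<open>Both terms of each binomial attain the minimum at \<open>w\<close>, so \<open>w\<close> is tropical and the initial
    system is again a binomial system with the same exponents.\<close>
  have tie: "rval (a $ i) + (\<chi> j. real_of_int (\<alpha> $ i $ j)) \<bullet> w =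
      rval (b $ i) + (\<chi> j. real_of_int (\<beta> $ i $ j)) \<bullet> w" for i
    using w_iff[of w] by (simp add: M inner_vec_def algebra_simps sum_subtractf)
  have trop: "w \<in> Trop_system B"
    using initial_form_binomial(1)[OF \<pi> rows nz tie]
    by (simp add: Trop_system_def B binomial_system_def)
  define \<delta>a where "\<delta>a = (\<chi> i. first_digit \<pi> (a $ i))"
  define \<delta>b where "\<delta>b = (\<chi> i. first_digit \<pi> (b $ i))"
  have \<delta>ab: "\<delta>a \<in> torus" "\<delta>b \<in> torus"
    using nz first_digit_nonzero[OF \<pi>] by (simp_all add: \<delta>a_def \<delta>b_def torus_def)
  have init: "initial_system \<pi> w B = binomial_system \<delta>a \<delta>b \<alpha> \<beta>"
    using initial_form_binomial(2)[OF \<pi> rows nz tie]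
    by (simp add: initial_system_def B binomial_system_def \<delta>a_def \<delta>b_def)
  have "\<delta>c = (\<chi> i. \<delta>b $ i / \<delta>a $ i)"
    using nz by (simp add: \<delta>c_def \<delta>a_def \<delta>b_def first_digit_divide[OF \<pi>])
  then have zeros_init: "torus_zeros (initial_system \<pi> w B) = {x \<in> torus. matrix_power_map x M = \<delta>c}"
    unfolding init torus_zeros_binomial_system[OF \<delta>ab] M by simp
  have "torus_zeros (initial_system \<pi> w B) = {} \<longleftrightarrow> {y. \<forall>i. y $ i \<in> T i} = {}"
    unfolding zeros_init bij_betw_imp_surj_on[OF bij_init, symmetric] image_is_empty ..
  also have "\<dots> \<longleftrightarrow> c3"
  proof
    assume empty: "{y. \<forall>i. y $ i \<in> T i} = {}"
    show c3
    proof (rule ccontr)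
      assume "\<not> c3"
      then have "\<exists>y. y \<in> T i" for i by (auto simp: c3_def)
      then have "(\<chi> i. SOME y. y \<in> T i) \<in> {y. \<forall>i. y $ i \<in> T i}" by (simp add: some_in_eq flip: ex_in_conv)
      with empty show False by blast
    qed
  qed (auto simp: c3_def)
  finally have init_empty: "torus_zeros (initial_system \<pi> w B) = {} \<longleftrightarrow> c3" .
  have "jacobian_det (initial_system \<pi> w B) x = 0 \<longleftrightarrow> \<not> c2"
    if "x \<in> torus_zeros (initial_system \<pi> w B)" for x
    using jacobian_det_binomial_system_eq_0_iff[OF \<delta>ab rows] that unfolding init c2_def M by simp
  then have semiregular: "semiregular \<pi> B w \<longleftrightarrow> c1 \<or> c2 \<or> c3"
    unfolding semiregular_def using trop init_empty by (auto simp: c1_def)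

  \<comment> \<open>A zero of \<open>B\<close> has value \<open>w\<close>, and its image under \<open>Q\<close> has digits solving the power equations
    over the residue field; so it excludes both \<open>c1\<close> and \<open>c3\<close>.\<close>
  have not_c1: "\<not> c1" if x: "x \<in> torus_zeros B" for x
  proof -
    have xt: "x \<in> torus" and xM: "matrix_power_map x M = c" using x by (auto simp: zeros_B)
    have "(\<chi> j. rval (x $ j)) = w"
      unfolding w_iff[symmetric]
      using rval_matrix_power_map[OF xt, of M] nz by (simp add: xM c_def rval_divide)
    then have w: "w = (\<chi> j. rval (x $ j))" ..
    have "x $ j \<noteq> 0" for j using xt by (simp add: torus_def)
    from rval_eq_int_multiple[OF \<pi> this] have "\<exists>m::int. w $ j = rval \<pi> * real_of_int m" for j
      unfolding w by auto
    then show ?thesis by (simp add: c1_def value_lattice_def)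
  qed
  have not_c3: "\<not> c3" if "x \<in> torus_zeros B" for x
    using bij_betwE[OF bij_B] that digit_S unfolding c3_def by blast

  have count: "finite (torus_zeros B) \<and>
      card (torus_zeros B) = (\<Prod>i\<in>UNIV. card {\<xi>::'a residue_field. \<xi> \<noteq> 0 \<and> \<xi> ^ d i = 1})"
    if "\<not> c1" "\<not> c3" c2
  proof -
    obtain m :: "'n \<Rightarrow> int" where m: "w $ j = rval \<pi> * of_int (m j)" for j
      using \<open>\<not> c1\<close> unfolding c1_def value_lattice_def by simp metis
    \<comment> \<open>A point of value \<open>w\<close>. It need not be a zero, but \<open>t\<^sup>M\<close> and \<open>c\<close> have the same values; comparing
      them shows that the value of \<open>e $ i\<close> is \<open>d i\<close> times that of an element of the field.\<close>
    define t where "t = (\<chi> j. \<pi> powi m j)"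
    have \<pi>0: "\<pi> \<noteq> 0" using uniformizer_minimal[OF \<pi>] by simp
    have t: "t \<in> torus" using \<pi>0 by (simp add: t_def torus_def)
    have "rval (t $ j) = w $ j" for j using \<pi>0 by (simp add: t_def m rval_power_int)
    then have rval_tM: "rval (matrix_power_map t M $ i) = rval (c $ i)" for i
      using w_iff[of w] nz by (simp add: rval_matrix_power_map[OF t] c_def rval_divide)
    have tM: "matrix_power_map t M \<in> torus" by (rule matrix_power_map_in_torus[OF t])
    have rval_e: "rval (e $ i) = real (d i) * rval (matrix_power_map t Q $ i)" for i
    proof -
      let ?y = "matrix_power_map t Q $ i"
      have y: "?y \<noteq> 0" "?y ^ d i = matrix_power_map (matrix_power_map t M) (matrix_inv P) $ i"
        using bij_betwE[OF bij_betw_monomial_solutions[OF snf tM]] t by simp_all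
      have "rval (e $ i) = rval (matrix_power_map (matrix_power_map t M) (matrix_inv P) $ i)"
        unfolding e_def rval_matrix_power_map[OF c] rval_matrix_power_map[OF tM] rval_tM ..
      also have "\<dots> = rval (?y ^ d i)" unfolding y(2) ..
      also have "\<dots> = real (d i) * rval ?y" by (rule rval_power[OF y(1)])
      finally show ?thesis .
    qed
    have tame: "of_nat (d i) \<noteq> (0 :: 'a residue_field)" for i
    proof
      assume "of_nat (d i) = (0 :: 'a residue_field)"
      then have "int CHAR('a residue_field) dvd int (d i)" by (simp add: of_nat_eq_0_iff_char_dvd)
      also have "int (d i) dvd (\<Prod>i\<in>UNIV. int (d i))" by (rule dvd_prodI) auto
      also have "\<dots> dvd det M" unfolding det_smith_normal_form[OF snf] by simp
      finally show False using \<open>c2\<close> by (simp add: c2_def)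
    qed
    have "bij_betw (first_digit \<pi>) (S i) (T i)" for i
    proof -
      have "matrix_power_map t Q $ i \<noteq> 0"
        using matrix_power_map_in_torus[OF t] by (simp add: torus_def)
      from rval_eq_int_multiple[OF \<pi> this] obtain k :: int
        where "rval (matrix_power_map t Q $ i) = rval \<pi> * of_int k" by blast
      with rval_e have "rval (e $ i) = real (d i) * (rval \<pi> * of_int k)" by simp
      from bij_betw_first_digit_roots[OF \<pi> tame e_nz this] show ?thesis
        by (simp add: S_def T_def \<epsilon>_e)
    qed
    then have "card (S i) = card (T i)" for i by (rule bij_betw_same_card)
    moreover have "card (T i) = card {\<xi>::'a residue_field. \<xi> \<noteq> 0 \<and> \<xi> ^ d i = 1}" for i
      using \<open>\<not> c3\<close> card_roots_eq_card_roots_of_unity unfolding c3_def T_def by blast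
    moreover have fin: "finite (S i)" for i
      using finite_subset[OF _ finite_roots[OF d[of i], of "e $ i"], of "S i"] by (auto simp: S_def)
    moreover have bij: "bij_betw (vec_nth \<circ> (\<lambda>x. matrix_power_map x Q)) (torus_zeros B) (PiE UNIV S)"
      by (rule bij_betw_trans[OF bij_B bij_betw_vec_PiE])
    ultimately show ?thesis
      using bij_betw_finite[OF bij] bij_betw_same_card[OF bij] by (simp add: card_PiE finite_PiE)
  qed

  have c3_iff: "c3 \<longleftrightarrow> (\<exists>i. \<not> (\<exists>y::'a residue_field. y \<noteq> 0 \<and>
      y ^ d i = matrix_power_map (\<chi> j. first_digit \<pi> (b $ j / a $ j)) (matrix_inv P) $ i))"
    by (auto simp: c3_def T_def \<epsilon>_def \<delta>c_def)
  have "(semiregular \<pi> B w \<longleftrightarrow> c1 \<or> c2 \<or> c3) \<and>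
      (semiregular \<pi> B w \<longrightarrow>
        (if \<not> c1 \<and> \<not> c3
         then finite (torus_zeros B) \<and>
              card (torus_zeros B) = (\<Prod>i\<in>UNIV. card {\<xi>::'a residue_field. \<xi> \<noteq> 0 \<and> \<xi> ^ d i = 1})
         else torus_zeros B = {}))"
    using semiregular count not_c1 not_c3 by auto
  then show ?thesis unfolding Let_def c1_def c2_def c3_iff .
qed

end
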